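(* Let $p\geq 2$ and let $d_1,\ldots,d_p$ be positive integers. Let $\mathcal{S}\subseteq\mathbb{C}^{d_1}\otimes\cdots\otimes\mathbb{C}^{d_p}$ be the subspace of all vectors $\mathbf{v}=(v_{(i_1,\ldots,i_p)})$ (with $0\leq i_k\leq d_k-1$) such that \[ \sum_{i_1+i_2+\cdots+i_p=s} v_{(i_1,\ldots,i_p)}=0\quad\text{for every } s\in\{0,1,2,\ldots,d_1+d_2+\cdots+d_p-p\}. \] Then for every density matrix $\rho\in M_{d_1}\otimes\cdots\otimes M_{d_p}$ with $\mathrm{supp}(\rho)\subseteq\mathcal{S}$, there is some $1\leq j<p$ such that the partial transpose of $\rho$ on the $j$-th subsystem is not positive semidefinite. In particular, $\mathcal{S}$ is an NPT subspace.
   Context: $M_d$ is the set of $d\times d$ complex matrices. A density matrix is a positive semidefinite matrix with trace $1$, and its support is its range. The entries of $\mathbf{v}\in\mathbb{C}^{d_1}\otimes\cdots\otimes\mathbb{C}^{d_p}$ are its coordinates in the standard product basis $|i_1\rangle\otimes\cdots\otimes|i_p\rangle$, where $\{|0\rangle,\ldots,|d_k-1\rangle\}$ is the standard basis of $\mathbb{C}^{d_k}$. For $A\subseteq\{1,\ldots,p\}$, the partial transpose on the subsystems in $A$ is the linear map on $M_{d_1}\otimes\cdots\otimes M_{d_p}$ acting as the transpose on the tensor factors indexed by $A$ and as the identity on the others; the partial transpose on the $j$-th subsystem is the case $A=\{j\}$. A subspace $\mathcal{S}\subseteq\mathbb{C}^{d_1}\otimes\cdots\otimes\mathbb{C}^{d_p}$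 is an NPT subspace if for every density matrix $\rho$ with $\mathrm{supp}(\rho)\subseteq\mathcal{S}$ there is some $A\subseteq\{1,\ldots,p\}$ such that the partial transpose of $\rho$ on the subsystems in $A$ is not positive semidefinite. *)

theory Defs
  imports Complex_Main "HOL-Library.FuncSet" "HOL-Library.Function_Algebras"
begin

text \<open>
  For a finite index set \<open>I\<close>, vectors of \<open>\<complex>\<^sup>I\<close> and \<open>I \<times> I\<close> complex matrices are represented by
  functions that vanish off \<open>I\<close> (respectively off \<open>I \<times> I\<close>).
\<close>

interpretation cfun: vector_space "\<lambda>(c::complex) (v::'i \<Rightarrow> complex) i. c * v i"
  by unfold_locales (auto simp: fun_eq_iff algebra_simps)

definition cvecs :: "'i set \<Rightarrow> ('i \<Rightarrow> complex) set" where
  "cvecs I = {v. \<forall>i. i \<notin> I \<longrightarrow> v i = 0}"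

definition cmats :: "'i set \<Rightarrow> ('i \<Rightarrow> 'i \<Rightarrow> complex) set" where
  "cmats I = {M. \<forall>i j. i \<notin> I \<or> j \<notin> I \<longrightarrow> M i j = 0}"

definition mat_apply :: "'i set \<Rightarrow> ('i \<Rightarrow> 'i \<Rightarrow> complex) \<Rightarrow> ('i \<Rightarrow> complex) \<Rightarrow> ('i \<Rightarrow> complex)" where
  "mat_apply I M v = (\<lambda>i. \<Sum>j\<in>I. M i j * v j)"

definition mat_supp :: "'i set \<Rightarrow> ('i \<Rightarrow> 'i \<Rightarrow> complex) \<Rightarrow> ('i \<Rightarrow> complex) set" where
  "mat_supp I M = mat_apply I M ` cvecs I"

definition hermitian_mat :: "'i set \<Rightarrow> ('i \<Rightarrow> 'i \<Rightarrow> complex) \<Rightarrow> bool" where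
  "hermitian_mat I M \<longleftrightarrow> (\<forall>i\<in>I. \<forall>j\<in>I. M i j = cnj (M j i))"

definition psd_mat :: "'i set \<Rightarrow> ('i \<Rightarrow> 'i \<Rightarrow> complex) \<Rightarrow> bool" where
  "psd_mat I M \<longleftrightarrow> hermitian_mat I M \<and>
     (\<forall>v\<in>cvecs I. 0 \<le> Re (\<Sum>i\<in>I. cnj (v i) * mat_apply I M v i))"

definition density_mat :: "'i set \<Rightarrow> ('i \<Rightarrow> 'i \<Rightarrow> complex) \<Rightarrow> bool" where
  "density_mat I \<rho> \<longleftrightarrow> \<rho> \<in> cmats I \<and> psd_mat I \<rho> \<and> (\<Sum>i\<in>I. \<rho> i i) = 1"

text \<open>
  The tensor product of \<open>\<complex>\<^bsup>d 1\<^esup>, \<dots>, \<complex>\<^bsup>d p\<^esup>\<close> is represented in its standard product basis, as \<open>\<complex>\<^sup>I\<close>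
  with \<open>I = multi_indices p d\<close>: the multi-index \<open>i\<close> stands for the basis vector
  \<open>|i 1\<rangle> \<otimes> \<dots> \<otimes> |i p\<rangle>\<close>.
\<close>

definition multi_indices :: "nat \<Rightarrow> (nat \<Rightarrow> nat) \<Rightarrow> (nat \<Rightarrow> nat) set" where
  "multi_indices p d = (\<Pi>\<^sub>E k\<in>{1..p}. {..<d k})"

definition tensor_mat ::
    "nat \<Rightarrow> (nat \<Rightarrow> nat) \<Rightarrow> (nat \<Rightarrow> nat \<Rightarrow> nat \<Rightarrow> complex) \<Rightarrow> (nat \<Rightarrow> nat) \<Rightarrow> (nat \<Rightarrow> nat) \<Rightarrow> complex" where
  "tensor_mat p d X = (\<lambda>i j. if i \<in> multi_indices p d \<and> j \<in> multi_indices p d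
     then \<Prod>k=1..p. X k (i k) (j k) else 0)"

text \<open>
  The row and column multi-indices exchange their components in \<open>A\<close>. This is the linear map that
  transposes the tensor factors in \<open>A\<close>; see \<open>partial_transpose_tensor_mat\<close> below.
\<close>

definition partial_transpose ::
    "nat set \<Rightarrow> ((nat \<Rightarrow> nat) \<Rightarrow> (nat \<Rightarrow> nat) \<Rightarrow> complex) \<Rightarrow> (nat \<Rightarrow> nat) \<Rightarrow> (nat \<Rightarrow> nat) \<Rightarrow> complex" where
  "partial_transpose A M = (\<lambda>i j. M (override_on i j A) (override_on j i A))"

lemma override_multi_indices_iff:
  "override_on i j A \<in> multi_indices p d \<and> override_on j i A \<in> multi_indices p d \<longleftrightarrow>
   i \<in> multi_indices p d \<and> j \<in> multi_indices p d"
  unfolding multi_indices_def PiE_iff extensional_def override_on_def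
  by (auto split: if_splits)

lemma partial_transpose_in_cmats:
  assumes "M \<in> cmats (multi_indices p d)"
  shows "partial_transpose A M \<in> cmats (multi_indices p d)"
  using assms override_multi_indices_iff[of _ _ A p d]
  unfolding cmats_def partial_transpose_def by blast

lemma partial_transpose_tensor_mat:
  "partial_transpose A (tensor_mat p d X) =
   tensor_mat p d (\<lambda>k. if k \<in> A then (\<lambda>a b. X k b a) else X k)"
  unfolding partial_transpose_def tensor_mat_def override_multi_indices_iff
  by (intro ext if_cong prod.cong refl) (auto simp: override_on_def)

definition NPT_subspace :: "nat \<Rightarrow> (nat \<Rightarrow> nat) \<Rightarrow> ((nat \<Rightarrow> nat) \<Rightarrow> complex) set \<Rightarrow> bool" where
  "NPT_subspace p d S \<longleftrightarrow>
     cfun.subspace S \<and> S \<subseteq> cvecs (multi_indices p d) \<and>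
     (\<forall>\<rho>. density_mat (multi_indices p d) \<rho> \<and> mat_supp (multi_indices p d) \<rho> \<subseteq> S \<longrightarrow>
       (\<exists>A\<subseteq>{1..p}. \<not> psd_mat (multi_indices p d) (partial_transpose A \<rho>)))"

definition zero_sum_subspace :: "nat \<Rightarrow> (nat \<Rightarrow> nat) \<Rightarrow> ((nat \<Rightarrow> nat) \<Rightarrow> complex) set" where
  "zero_sum_subspace p d = {v \<in> cvecs (multi_indices p d).
     \<forall>s \<in> {0..(\<Sum>k=1..p. d k) - p}. (\<Sum>i | i \<in> multi_indices p d \<and> (\<Sum>k=1..p. i k) = s. v i) = 0}"

end

theory Submission
  imports Defs
begin

text \<open>
  Suppose the partial transposes of \<open>\<rho>\<close> on the subsystems \<open>j < p\<close> are all positive semidefinite.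
  By induction on the level \<open>s = i 1 + \<dots> + i p\<close>, every diagonal entry \<open>\<rho> i i\<close> vanishes, which
  contradicts the trace being \<open>1\<close>. Indeed, distinct \<open>i\<close>, \<open>j\<close> of level \<open>s\<close> differ in some component
  \<open>k < p\<close>. Exchanging that component moves \<open>\<rho> i j\<close> to an entry of the partial transpose whose row and
  column have levels adding up to \<open>2 s\<close>, one of them below \<open>s\<close>. Partial transposition keeps the
  diagonal, so the diagonal entry at that lower level is \<open>0\<close> and positivity forces \<open>\<rho> i j = 0\<close>.
  Since column \<open>i\<close> of \<open>\<rho>\<close> lies in the subspace, its entries of level \<open>s\<close> add up to \<open>0\<close>; hence
  \<open>\<rho> i i = 0\<close>.
\<close>

text \<open>On the vector with entry \<open>c\<close> at \<open>i\<close> and \<open>1\<close> at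
  \<open>j\<close>, the vanishing diagonal entry removes the term quadratic in \<open>c\<close>. The
  form is then real-affine in \<open>c\<close>, and it stays nonnegative for all \<open>c\<close>
  only if \<open>M i j = 0\<close>.\<close>

lemma psd_mat_zero_diag:
  assumes "finite I" and psd: "psd_mat I M" and "i \<in> I" "j \<in> I" and diag: "M i i = 0"
  shows "M i j = 0"
proof (cases "i = j")
  case False
  have ji: "M j i = cnj (M i j)"
    using psd \<open>i \<in> I\<close> \<open>j \<in> I\<close> unfolding psd_mat_def hermitian_mat_def by blast
  have ge: "0 \<le> Re (cnj c * M i j + (M j i * c + M j j))" for c
  proof -
    define v where "v = (\<lambda>k. if k = i then c else if k = j then 1 else 0)"
    have restrict: "(\<Sum>k\<in>I. f k) = f i + f j" if "\<And>k. k \<noteq> i \<Longrightarrow> k \<noteq> j \<Longrightarrow> f k = 0"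
      for f :: "'a \<Rightarrow> complex"
    proof -
      have "(\<Sum>k\<in>I. f k) = (\<Sum>k\<in>{i, j}. f k)"
        using assms that by (intro sum.mono_neutral_right) auto
      then show ?thesis using False by simp
    qed
    have app: "mat_apply I M v k = M k i * c + M k j" for k
      unfolding mat_apply_def using False by (subst restrict) (auto simp: v_def)
    have "v \<in> cvecs I"
      using \<open>i \<in> I\<close> \<open>j \<in> I\<close> by (auto simp: v_def cvecs_def)
    then have "0 \<le> Re (\<Sum>k\<in>I. cnj (v k) * mat_apply I M v k)"
      using psd by (simp add: psd_mat_def)
    also have "(\<Sum>k\<in>I. cnj (v k) * mat_apply I M v k) = cnj c * M i j + (M j i * c + M j j)"
      using False by (subst restrict) (simp_all add: app, simp_all add: v_def diag)
    finally show ?thesis .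
  qed
  show ?thesis
  proof (rule ccontr)
    assume "M i j \<noteq> 0"
    define n where "n = (cmod (M i j))\<^sup>2"
    have "n > 0" using \<open>M i j \<noteq> 0\<close> by (simp add: n_def)
    \<comment> \<open>With \<open>c = - t * M i j\<close> each of the two cross terms equals
      \<open>- t * n\<close>. This \<open>t\<close> makes their sum
      \<open>- 2 * (\<bar>Re (M j j)\<bar> + 1)\<close>, which outweighs
      \<open>M j j\<close>.\<close>
    define t where "t = (\<bar>Re (M j j)\<bar> + 1) / n"
    have "M i j * cnj (M i j) = of_real n"
      unfolding n_def by (rule complex_norm_square[symmetric])
    then have eq: "cnj (- of_real t * M i j) * M i j + (M j i * (- of_real t * M i j) + M j j)
        = of_real (- 2 * t * n) + M j j"
      by (simp add: ji algebra_simps)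
    have "0 \<le> - 2 * t * n + Re (M j j)"
      using ge[of "- of_real t * M i j"] unfolding eq by simp
    moreover have "t * n = \<bar>Re (M j j)\<bar> + 1"
      using \<open>n > 0\<close> by (simp add: t_def)
    ultimately show False by linarith
  qed
qed (use diag in simp)

lemma finite_multi_indices: "finite (multi_indices p d)"
  unfolding multi_indices_def by (intro finite_PiE) auto

text \<open>Each component is at most \<open>d k - 1\<close>. Hence every level that occurs is one
  of the values \<open>s\<close> constrained in \<open>zero_sum_subspace\<close>.\<close>

lemma sum_multi_index_le:
  assumes "i \<in> multi_indices p d"
  shows "(\<Sum>k=1..p. i k) \<le> (\<Sum>k=1..p. d k) - p"
proof -
  have "i k < d k" if "k \<in> {1..p}" for k
    using assms that by (auto simp: multi_indices_def PiE_iff)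
  then have "(\<Sum>k=1..p. i k + 1) \<le> (\<Sum>k=1..p. d k)"
    by (intro sum_mono) (simp add: Suc_leI)
  then show ?thesis
    by (subst (asm) sum.distrib) simp
qed

text \<open>Once all earlier components agree, equal sums force the last ones to agree too. This is
  why transposing subsystems \<open>j < p\<close> suffices.\<close>

lemma same_level_differ_before_last:
  fixes i j :: "nat \<Rightarrow> nat"
  assumes "i \<in> multi_indices p d" "j \<in> multi_indices p d" "i \<noteq> j"
    and level: "(\<Sum>k=1..p. i k) = (\<Sum>k=1..p. j k)"
  shows "\<exists>k. 1 \<le> k \<and> k < p \<and> i k \<noteq> j k"
proof (rule ccontr)
  assume "\<not> ?thesis"
  then have eq: "i k = j k" if "1 \<le> k" "k < p" for k
    using that by blast
  have "i p = j p" if "p \<ge> 1"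
  proof -
    have split: "(\<Sum>k=1..p. f k) = f p + (\<Sum>k=1..<p. f k)" for f :: "nat \<Rightarrow> nat"
      using that by (metis atLeastLessThanSuc_atLeastAtMost sum.atLeastLessThan_Suc add.commute)
    have "(\<Sum>k=1..<p. i k) = (\<Sum>k=1..<p. j k)"
      by (intro sum.cong) (auto intro: eq)
    with level show ?thesis unfolding split by linarith
  qed
  then have "i k = j k" if "k \<in> {1..p}" for k
    using eq[of k] that by (cases "k = p") auto
  then have "i = j"
    using assms(1,2) unfolding multi_indices_def by (intro PiE_ext) auto
  with \<open>i \<noteq> j\<close> show False ..
qed

lemma sum_override_on_less:
  fixes i j :: "nat \<Rightarrow> nat"
  assumes "k \<in> A" "finite A" "j k < i k"
  shows "(\<Sum>l\<in>A. override_on i j {k} l) < (\<Sum>l\<in>A. i l)"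
  using assms by (intro sum_strict_mono_ex1) (auto simp: override_on_def)

lemma zero_sum_subspace_is_subspace: "cfun.subspace (zero_sum_subspace p d)"
  by (rule cfun.subspaceI)
    (auto simp: zero_sum_subspace_def cvecs_def sum.distrib simp flip: sum_distrib_left)

text \<open>Column \<open>j\<close> is the image of the \<open>j\<close>-th basis vector. This turns
  the support condition into linear relations within each column.\<close>

lemma column_in_mat_supp:
  assumes "finite I" "j \<in> I"
  shows "(\<lambda>i. M i j) \<in> mat_supp I M"
  unfolding mat_supp_def
proof (rule image_eqI)
  show "(\<lambda>i. M i j) = mat_apply I M (\<lambda>k. if k = j then 1 else 0)"
    using assms by (simp add: mat_apply_def if_distrib cong: if_cong)
  show "(\<lambda>k. if k = j then 1 else 0) \<in> cvecs I"
    using assms by (auto simp: cvecs_def)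
qed

lemma diag_partial_transpose: "partial_transpose A M i i = M i i"
  by (simp add: partial_transpose_def override_on_def)

lemma partial_transpose_override_on:
  "partial_transpose A M (override_on i j A) (override_on j i A) = M i j"
proof -
  have "override_on (override_on i j A) (override_on j i A) A = i" for i j :: "nat \<Rightarrow> nat"
    by (auto simp: override_on_def)
  then show ?thesis by (simp add: partial_transpose_def)
qed

lemma ppt_zero_sum_diag:
  assumes supp: "mat_supp (multi_indices p d) \<rho> \<subseteq> zero_sum_subspace p d"
    and psd: "psd_mat (multi_indices p d) \<rho>"
    and ppt: "\<And>j. 1 \<le> j \<Longrightarrow> j < p \<Longrightarrow> psd_mat (multi_indices p d) (partial_transpose {j} \<rho>)"
    and "i \<in> multi_indices p d"
  shows "\<rho> i i = 0"
  using \<open>i \<in> multi_indices p d\<close>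
proof (induction "\<Sum>k=1..p. i k" arbitrary: i rule: less_induct)
  case less
  define L where "L = {j \<in> multi_indices p d. (\<Sum>k=1..p. j k) = (\<Sum>k=1..p. i k)}"
  have exchange_zero: "\<rho> a b = 0"
    if a: "a \<in> L" and b: "b \<in> multi_indices p d" and k: "1 \<le> k" "k < p" "b k < a k" for a b k
  proof -
    let ?a = "override_on a b {k}" and ?b = "override_on b a {k}"
    have mem: "?a \<in> multi_indices p d" "?b \<in> multi_indices p d"
      using override_multi_indices_iff[of a b "{k}" p d] a b by (auto simp: L_def)
    \<comment> \<open>Replacing \<open>a k\<close> by the smaller \<open>b k\<close> lowers the
      level, so the induction hypothesis applies to the row \<open>?a\<close>.\<close>
    have "(\<Sum>l=1..p. ?a l) < (\<Sum>l=1..p. a l)"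
      using k by (intro sum_override_on_less) auto
    then have "\<rho> ?a ?a = 0"
      using less.hyps[of ?a] mem a by (simp add: L_def)
    then have "partial_transpose {k} \<rho> ?a ?b = 0"
      using psd_mat_zero_diag[OF finite_multi_indices ppt[OF k(1,2)] mem]
      by (simp add: diag_partial_transpose)
    then show ?thesis by (simp add: partial_transpose_override_on)
  qed
  have off_diag: "\<rho> j i = 0" if j: "j \<in> L" "j \<noteq> i" for j
  proof -
    have i: "i \<in> L" using less.prems by (simp add: L_def)
    obtain k where k: "1 \<le> k" "k < p" "j k \<noteq> i k"
      using same_level_differ_before_last[of j p d i] j less.prems by (auto simp: L_def)
    show ?thesis
    \<comment> \<open>The row must be the index with the larger component \<open>k\<close>. If that
      is \<open>i\<close>, the entry \<open>\<rho> i j\<close> is treated instead and Hermitian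
      symmetry gives \<open>\<rho> j i\<close>.\<close>
    proof (cases "i k < j k")
      case True
      then show ?thesis using exchange_zero[of j i k] j k less.prems by simp
    next
      case False
      then have "\<rho> i j = 0" using exchange_zero[of i j k] i j k by (simp add: L_def)
      moreover have "\<rho> j i = cnj (\<rho> i j)"
        using psd j less.prems unfolding psd_mat_def hermitian_mat_def L_def by blast
      ultimately show ?thesis by simp
    qed
  qed
  have "(\<lambda>j. \<rho> j i) \<in> zero_sum_subspace p d"
    using column_in_mat_supp[OF finite_multi_indices less.prems] supp by blast
  then have "(\<Sum>j\<in>L. \<rho> j i) = 0"
    using sum_multi_index_le[OF less.prems] by (simp add: zero_sum_subspace_def L_def)
  also have "(\<Sum>j\<in>L. \<rho> j i) = (\<Sum>j\<in>{i}. \<rho> j i)"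
    using less.prems off_diag
    by (intro sum.mono_neutral_right) (auto simp: L_def finite_multi_indices)
  finally show ?case by simp
qed

lemma zero_sum_density_npt:
  assumes "density_mat (multi_indices p d) \<rho>"
    and "mat_supp (multi_indices p d) \<rho> \<subseteq> zero_sum_subspace p d"
  shows "\<exists>j. 1 \<le> j \<and> j < p \<and> \<not> psd_mat (multi_indices p d) (partial_transpose {j} \<rho>)"
proof (rule ccontr)
  assume "\<not> ?thesis"
  then have "\<rho> i i = 0" if "i \<in> multi_indices p d" for i
    using ppt_zero_sum_diag[of p d \<rho> i] assms that by (auto simp: density_mat_def)
  then show False
    using assms(1) by (simp add: density_mat_def)
qed

theorem theorem7:
  fixes p :: nat and d :: "nat \<Rightarrow> nat"
  assumes "p \<ge> 2" and "\<And>k. k \<in> {1..p} \<Longrightarrow> d k \<ge> 1"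
  shows "(\<forall>\<rho>. density_mat (multi_indices p d) \<rho> \<and>
             mat_supp (multi_indices p d) \<rho> \<subseteq> zero_sum_subspace p d \<longrightarrow>
             (\<exists>j. 1 \<le> j \<and> j < p \<and>
               \<not> psd_mat (multi_indices p d) (partial_transpose {j} \<rho>)))
         \<and> NPT_subspace p d (zero_sum_subspace p d)"
proof (intro conjI allI impI)
  show "\<exists>j. 1 \<le> j \<and> j < p \<and> \<not> psd_mat (multi_indices p d) (partial_transpose {j} \<rho>)"
    if "density_mat (multi_indices p d) \<rho> \<and>
        mat_supp (multi_indices p d) \<rho> \<subseteq> zero_sum_subspace p d" for \<rho>
    using that zero_sum_density_npt by blast
  have "\<exists>A\<subseteq>{1..p}. \<not> psd_mat (multi_indices p d) (partial_transpose A \<rho>)"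
    if \<rho>: "density_mat (multi_indices p d) \<rho>"
      "mat_supp (multi_indices p d) \<rho> \<subseteq> zero_sum_subspace p d" for \<rho>
  proof -
    obtain j where "1 \<le> j" "j < p" "\<not> psd_mat (multi_indices p d) (partial_transpose {j} \<rho>)"
      using zero_sum_density_npt[OF \<rho>] by blast
    then show ?thesis by (intro exI[of _ "{j}"]) auto
  qed
  then show "NPT_subspace p d (zero_sum_subspace p d)"
    using zero_sum_subspace_is_subspace
    by (auto simp: NPT_subspace_def zero_sum_subspace_def)
qed

end
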